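(* Let $(\pi,\mathcal{H}_S)$ be a finite-dimensional unitary representation of $\mathrm{SU}(d)$ on the Hilbert space of a physical system. Let $\mathcal{E}\subseteq\mathcal{B}(\mathcal{H}_S)$ be a set of error operators, and let $\mathcal{E}^2=\{E_p^\dagger E_q: E_p,E_q\in\mathcal{E}\}$. Let $V_{\mathcal{E}}\supseteq\mathcal{E}$ and $V_{\mathcal{E}^2}\supseteq\mathcal{E}^2$ be linear subspaces of $\mathcal{B}(\mathcal{H}_S)$ closed under the conjugation action of $\mathrm{SU}(d)$. Let $\mathcal{G}<\mathrm{SU}(d)$ be a finite subgroup, and let $\mathcal{H}_C=\mathrm{span}\{|\psi_i\rangle\}_{i=1}^k$ be a $k$-dimensional subspace of $\mathcal{H}_S$ spanned by orthonormal states satisfying $$\pi(g)|\psi_i\rangle=e^{i\theta(g)}|\psi_i\rangle\qquad\forall i,\ \forall g\in\mathcal{G}$$ for some real phase $\theta(g)$ independent of $i$. Then: 1. If $\mathcal{G}$ is a decoupling group for $\mathcal{E}$, then $\mathcal{H}_C$ is a quantum error-detecting code for $\mathcal{E}$. 2. If $\mathcal{G}$ is a decoupling group for $\mathcal{E}^2$, then $\mathcal{H}_C$ satisfies the Knill-Laflamme conditions for $\mathcal{E}$, and hence is a quantum error-correcting code. 3. If $\mathcal{G}$ is an inaccessible symmetry for $V_{\mathcal{E}}$, then $\mathcal{H}_C$ is a quantum error-detecting code for $\mathcal{E}$. 4. If $\mathcal{G}$ is an inaccessible symmetry for $V_{\mathcal{E}^2}$, then $\mathcal{H}_C$ satisfies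 the Knill-Laflamme conditions for $\mathcal{E}$, and hence is a quantum error-correcting code.
   Context: $\mathcal{B}(\mathcal{H}_S)$ is the space of linear operators on $\mathcal{H}_S$; $\mathrm{SU}(d)$ acts on it by $O\mapsto\pi(g)O\pi(g)^\dagger$. Put $\Pi_{\mathcal{G}}(S)=\frac{1}{|\mathcal{G}|}\sum_{g\in\mathcal{G}}\pi(g)^{\dagger}S\,\pi(g)$. Decoupling group: $\mathcal{G}$ is a decoupling group for a set of operators if $\Pi_{\mathcal{G}}$ maps each of them to a scalar multiple (possibly zero) of the identity. Inaccessible symmetry: $\mathcal{G}$ is an inaccessible symmetry for $V\subseteq\mathcal{B}(\mathcal{H}_S)$ if the subspace of elements of $V$ fixed by conjugation by all $\pi(g)$, $g\in\mathcal{G}$, is $\{0\}$ or the span of the identity. Error-detecting code for $\mathcal{E}$: for each $E\in\mathcal{E}$ there is a constant $C_E$ with $\langle\psi_i|E|\psi_j\rangle=\delta_{ij}C_E$ for all $i,j$. Knill-Laflamme conditions for $\mathcal{E}$ (the criterion for being a quantum error-correcting code): for all $E_p,E_q\in\mathcal{E}$ there is a constant $C_{pq}$ with $\langle\psi_i|E_p^\dagger E_q|\psi_j\rangle=\delta_{ij}C_{pq}$ for all $i,j$. *)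

theory Defs
  imports "HOL-Analysis.Analysis" "HOL-Algebra.Group"
begin

text \<open>
  The Hilbert space is \<open>complex ^ 'n\<close> with its standard inner product, and operators on it are the
  square matrices \<open>complex ^ 'n ^ 'n\<close>, acting by \<open>(*v)\<close> and composed by \<open>(**)\<close>.
\<close>

section \<open>Inner product, adjoint, and the complex vector space of operators\<close>

definition braket :: "complex ^ 'n \<Rightarrow> complex ^ 'n \<Rightarrow> complex" where
  "braket x y = (\<Sum>i\<in>UNIV. cnj (x $ i) * y $ i)"

definition dagger :: "complex ^ 'n ^ 'm \<Rightarrow> complex ^ 'm ^ 'n" where
  "dagger A = (\<chi> i j. cnj (A $ j $ i))"

text \<open>
  The library's \<open>(*s)\<close> scales a vector by its entries' own type and \<open>(*\<^sub>R)\<close> is real scaling, so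
  complex scaling of a matrix has to be introduced.
\<close>

definition mscale :: "complex \<Rightarrow> complex ^ 'n ^ 'm \<Rightarrow> complex ^ 'n ^ 'm" where
  "mscale c A = (\<chi> i j. c * A $ i $ j)"

interpretation cmat: vector_space "mscale :: complex \<Rightarrow> complex ^ 'n ^ 'm \<Rightarrow> complex ^ 'n ^ 'm"
  by unfold_locales (simp_all add: mscale_def vec_eq_iff algebra_simps)

section \<open>The groups and their representations\<close>

definition unitary_matrix :: "complex ^ 'n ^ 'n \<Rightarrow> bool" where
  "unitary_matrix A \<longleftrightarrow> dagger A ** A = mat 1 \<and> A ** dagger A = mat 1"

definition U_group :: "(complex ^ 'n ^ 'n) monoid" where
  "U_group = \<lparr>carrier = {A. unitary_matrix A}, mult = (**), one = mat 1\<rparr>"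

definition SU_group :: "(complex ^ 'd ^ 'd) monoid" where
  "SU_group = \<lparr>carrier = {A. unitary_matrix A \<and> det A = 1}, mult = (**), one = mat 1\<rparr>"

lemma dagger_dagger [simp]: "dagger (dagger A) = A"
  by (simp add: dagger_def vec_eq_iff)

lemma dagger_mult: "dagger (A ** B) = dagger B ** dagger A"
  by (simp add: dagger_def matrix_matrix_mult_def vec_eq_iff mult.commute)

lemma dagger_mat_1 [simp]: "dagger (mat 1) = mat 1"
  by (simp add: dagger_def mat_def vec_eq_iff)

lemma unitary_matrix_mat_1: "unitary_matrix (mat 1)"
  by (simp add: unitary_matrix_def)

lemma unitary_matrix_dagger: "unitary_matrix A \<Longrightarrow> unitary_matrix (dagger A)"
  by (simp add: unitary_matrix_def)

lemma unitary_matrix_mult: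
  assumes "unitary_matrix A" "unitary_matrix B"
  shows "unitary_matrix (A ** B)"
proof -
  have "dagger (A ** B) ** (A ** B) = dagger B ** (dagger A ** A) ** B"
    by (simp add: dagger_mult matrix_mul_assoc)
  moreover have "(A ** B) ** dagger (A ** B) = A ** (B ** dagger B) ** dagger A"
    by (simp add: dagger_mult matrix_mul_assoc)
  ultimately show ?thesis
    using assms by (simp add: unitary_matrix_def)
qed

lemma group_U_group: "group (U_group :: (complex ^ 'n ^ 'n) monoid)"
proof (rule groupI)
  fix A :: "complex ^ 'n ^ 'n"
  assume "A \<in> carrier U_group"
  then show "\<exists>B\<in>carrier U_group. B \<otimes>\<^bsub>U_group\<^esub> A = \<one>\<^bsub>U_group\<^esub>"
    by (intro bexI[of _ "dagger A"])
      (auto simp: U_group_def unitary_matrix_dagger, simp add: unitary_matrix_def)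
qed (auto simp: U_group_def unitary_matrix_mult unitary_matrix_mat_1 matrix_mul_assoc)

lemma group_SU_group: "group (SU_group :: (complex ^ 'd ^ 'd) monoid)"
proof (rule groupI)
  fix A :: "complex ^ 'd ^ 'd"
  assume A: "A \<in> carrier SU_group"
  then have inv: "dagger A ** A = mat 1"
    by (simp add: SU_group_def unitary_matrix_def)
  then have "det (dagger A) * det A = 1"
    by (metis det_I det_mul)
  with A inv show "\<exists>B\<in>carrier SU_group. B \<otimes>\<^bsub>SU_group\<^esub> A = \<one>\<^bsub>SU_group\<^esub>"
    by (intro bexI[of _ "dagger A"]) (auto simp: SU_group_def unitary_matrix_dagger)
qed (auto simp: SU_group_def unitary_matrix_mult unitary_matrix_mat_1 matrix_mul_assoc det_mul)

text \<open>As usual for a Lie group, a unitary representation is required to be continuous.\<close>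

definition unitary_rep :: "(complex ^ 'd ^ 'd \<Rightarrow> complex ^ 'n ^ 'n) \<Rightarrow> bool" where
  "unitary_rep \<pi> \<longleftrightarrow> \<pi> \<in> hom SU_group U_group \<and> continuous_on (carrier SU_group) \<pi>"

definition conj_action ::
    "(complex ^ 'd ^ 'd \<Rightarrow> complex ^ 'n ^ 'n) \<Rightarrow> complex ^ 'd ^ 'd \<Rightarrow> complex ^ 'n ^ 'n \<Rightarrow> complex ^ 'n ^ 'n"
  where "conj_action \<pi> g A = \<pi> g ** A ** dagger (\<pi> g)"

definition closed_under_conj ::
    "(complex ^ 'd ^ 'd \<Rightarrow> complex ^ 'n ^ 'n) \<Rightarrow> (complex ^ 'n ^ 'n) set \<Rightarrow> bool" where
  "closed_under_conj \<pi> V \<longleftrightarrow> (\<forall>g\<in>carrier SU_group. \<forall>A\<in>V. conj_action \<pi> g A \<in> V)"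

section \<open>Decoupling groups and inaccessible symmetries\<close>

definition twirl ::
    "(complex ^ 'd ^ 'd \<Rightarrow> complex ^ 'n ^ 'n) \<Rightarrow> (complex ^ 'd ^ 'd) set \<Rightarrow> complex ^ 'n ^ 'n \<Rightarrow> complex ^ 'n ^ 'n"
  where "twirl \<pi> G S = mscale (1 / of_nat (card G)) (\<Sum>g\<in>G. dagger (\<pi> g) ** S ** \<pi> g)"

definition decoupling_group ::
    "(complex ^ 'd ^ 'd \<Rightarrow> complex ^ 'n ^ 'n) \<Rightarrow> (complex ^ 'd ^ 'd) set \<Rightarrow> (complex ^ 'n ^ 'n) set \<Rightarrow> bool"
  where "decoupling_group \<pi> G \<S> \<longleftrightarrow> (\<forall>S\<in>\<S>. \<exists>c. twirl \<pi> G S = mscale c (mat 1))"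

definition fixed_operators ::
    "(complex ^ 'd ^ 'd \<Rightarrow> complex ^ 'n ^ 'n) \<Rightarrow> (complex ^ 'd ^ 'd) set \<Rightarrow> (complex ^ 'n ^ 'n) set
      \<Rightarrow> (complex ^ 'n ^ 'n) set"
  where "fixed_operators \<pi> G V = {A \<in> V. \<forall>g\<in>G. conj_action \<pi> g A = A}"

definition inaccessible_symmetry ::
    "(complex ^ 'd ^ 'd \<Rightarrow> complex ^ 'n ^ 'n) \<Rightarrow> (complex ^ 'd ^ 'd) set \<Rightarrow> (complex ^ 'n ^ 'n) set \<Rightarrow> bool"
  where "inaccessible_symmetry \<pi> G V \<longleftrightarrow>
    fixed_operators \<pi> G V = {0} \<or> fixed_operators \<pi> G V = cmat.span {mat 1}"

section \<open>Codes\<close>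

definition error_products :: "(complex ^ 'n ^ 'n) set \<Rightarrow> (complex ^ 'n ^ 'n) set" where
  "error_products \<E> = {dagger E\<^sub>p ** E\<^sub>q | E\<^sub>p E\<^sub>q. E\<^sub>p \<in> \<E> \<and> E\<^sub>q \<in> \<E>}"

definition orthonormal_basis :: "nat \<Rightarrow> (nat \<Rightarrow> complex ^ 'n) \<Rightarrow> (complex ^ 'n) set \<Rightarrow> bool" where
  "orthonormal_basis k \<psi> C \<longleftrightarrow>
    (\<forall>i\<in>{1..k}. \<forall>j\<in>{1..k}. braket (\<psi> i) (\<psi> j) = (if i = j then 1 else 0)) \<and>
    vec.span (\<psi> ` {1..k}) = C"

text \<open>
  Being a code is a property of the subspace \<open>C\<close>, so the conditions are imposed for all of its
  orthonormal bases \<open>\<psi>\<^sub>1, \<dots>, \<psi>\<^sub>k\<close>; in particular they hold for whichever basis \<open>C\<close> was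
  given by.
\<close>

definition error_detecting_code :: "(complex ^ 'n) set \<Rightarrow> (complex ^ 'n ^ 'n) set \<Rightarrow> bool" where
  "error_detecting_code C \<E> \<longleftrightarrow>
    (\<forall>k \<psi>. orthonormal_basis k \<psi> C \<longrightarrow>
      (\<forall>E\<in>\<E>. \<exists>c. \<forall>i\<in>{1..k}. \<forall>j\<in>{1..k}.
        braket (\<psi> i) (E *v \<psi> j) = (if i = j then c else 0)))"

definition knill_laflamme :: "(complex ^ 'n) set \<Rightarrow> (complex ^ 'n ^ 'n) set \<Rightarrow> bool" where
  "knill_laflamme C \<E> \<longleftrightarrow>
    (\<forall>k \<psi>. orthonormal_basis k \<psi> C \<longrightarrow>
      (\<forall>E\<^sub>p\<in>\<E>. \<forall>E\<^sub>q\<in>\<E>. \<exists>c. \<forall>i\<in>{1..k}. \<forall>j\<in>{1..k}.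
        braket (\<psi> i) ((dagger E\<^sub>p ** E\<^sub>q) *v \<psi> j) = (if i = j then c else 0)))"

text \<open>The Knill-Laflamme conditions are taken as the criterion for being an error-correcting code.\<close>

definition error_correcting_code :: "(complex ^ 'n) set \<Rightarrow> (complex ^ 'n ^ 'n) set \<Rightarrow> bool" where
  "error_correcting_code C \<E> \<longleftrightarrow> knill_laflamme C \<E>"

end

theory Submission
  imports Defs
begin

text \<open>
  All group elements act on the code space by a common phase, so a matrix element
  \<open>\<langle>x|S|y\<rangle>\<close> between code vectors does not change when \<open>S\<close> is replaced by its twirl: the two phases
  cancel in every summand. Decoupling says directly that the twirl is scalar. For an inaccessible
  symmetry, the twirl of an element of \<open>V\<close> lies in \<open>V\<close> and is fixed by the group, hence is again
  scalar.
\<close>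

text \<open>Swapping the two finite sums identifies the entrywise conjugate transpose with the
  adjoint for \<open>braket\<close>.\<close>

lemma braket_dagger: "braket x (dagger A *v y) = braket (A *v x) y"
proof -
  have "braket x (dagger A *v y) = (\<Sum>i\<in>UNIV. \<Sum>j\<in>UNIV. cnj (x $ i) * (cnj (A $ j $ i) * y $ j))"
    by (simp add: braket_def dagger_def matrix_vector_mult_def sum_distrib_left)
  also have "\<dots> = (\<Sum>j\<in>UNIV. \<Sum>i\<in>UNIV. cnj (x $ i) * (cnj (A $ j $ i) * y $ j))"
    by (rule sum.swap)
  also have "\<dots> = braket (A *v x) y"
    by (simp add: braket_def matrix_vector_mult_def sum_distrib_left sum_distrib_right mult_ac)
  finally show ?thesis .
qed

lemma braket_scale: "braket (a *s x) (b *s y) = cnj a * b * braket x y"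
  by (simp add: braket_def sum_distrib_left mult_ac)

lemma braket_scale_right: "braket x (b *s y) = b * braket x y"
  using braket_scale[of 1 x b y] by simp

lemma braket_sum_right: "braket x (\<Sum>g\<in>G. f g) = (\<Sum>g\<in>G. braket x (f g))"
  unfolding braket_def sum_component sum_distrib_left by (rule sum.swap)

lemma mscale_mult_vec: "mscale c A *v x = c *s (A *v x)"
  by (simp add: mscale_def matrix_vector_mult_def vec_eq_iff sum_distrib_left mult_ac)

lemma sum_mult_vec: "(\<Sum>g\<in>G. f g) *v x = (\<Sum>g\<in>G. f g *v x)"
  by (induction G rule: infinite_finite_induct) (simp_all add: matrix_vector_mult_add_rdistrib)

lemma sandwich_mscale: "P ** mscale c A ** Q = mscale c (P ** A ** Q)"
  by (simp add: mscale_def matrix_matrix_mult_def vec_eq_iff sum_distrib_left sum_distrib_right mult_ac)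

lemma sandwich_sum:
  fixes f :: "'b \<Rightarrow> complex ^ 'm ^ 'n"
  shows "P ** (\<Sum>g\<in>G. f g) ** Q = (\<Sum>g\<in>G. P ** f g ** Q)"
  by (induction G rule: infinite_finite_induct)
    (simp_all add: matrix_add_ldistrib matrix_matrix_mult_def vec_eq_iff
      distrib_left distrib_right sum.distrib)

lemma inv_U_group:
  assumes "A \<in> carrier U_group"
  shows "inv\<^bsub>U_group\<^esub> A = dagger A"
proof (rule group.inv_equality[OF group_U_group])
  show "dagger A \<otimes>\<^bsub>U_group\<^esub> A = \<one>\<^bsub>U_group\<^esub>"
    using assms by (simp add: U_group_def unitary_matrix_def)
qed (use assms in \<open>auto simp: U_group_def unitary_matrix_dagger\<close>)

lemma unitary_rep_group_hom: "unitary_rep \<pi> \<Longrightarrow> group_hom SU_group U_group \<pi>"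
  by (simp add: unitary_rep_def group_hom_def group_hom_axioms_def group_SU_group group_U_group)

text \<open>Homomorphisms preserve inverses, and in the unitary group the inverse is the
  adjoint.\<close>

lemma unitary_rep_inv:
  assumes "unitary_rep \<pi>" "g \<in> carrier SU_group"
  shows "\<pi> (inv\<^bsub>SU_group\<^esub> g) = dagger (\<pi> g)"
  using group_hom.hom_inv[OF unitary_rep_group_hom] group_hom.hom_closed[OF unitary_rep_group_hom]
    assms inv_U_group by metis

lemma unitary_rep_mult:
  assumes "unitary_rep \<pi>" "g \<in> carrier SU_group" "h \<in> carrier SU_group"
  shows "\<pi> (g \<otimes>\<^bsub>SU_group\<^esub> h) = \<pi> g ** \<pi> h"
  using group_hom.hom_mult[OF unitary_rep_group_hom[OF assms(1)] assms(2,3)]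
  by (simp add: U_group_def)

lemma twirl_in_subspace:
  assumes rep: "unitary_rep \<pi>" and G: "G \<subseteq> carrier SU_group"
    and V: "cmat.subspace V" "closed_under_conj \<pi> V" "S \<in> V"
  shows "twirl \<pi> G S \<in> V"
  unfolding twirl_def
proof (intro cmat.subspace_scale cmat.subspace_sum V(1))
  fix g assume "g \<in> G"
  then have g: "g \<in> carrier SU_group"
    using G by auto
  \<comment> \<open>The twirl has the adjoint on the left, so its summand at \<open>g\<close> is the
    conjugation action of the inverse of \<open>g\<close>; closure of \<open>V\<close> is therefore
    applied there.\<close>
  have "conj_action \<pi> (inv\<^bsub>SU_group\<^esub> g) S \<in> V"
    using V g group.inv_closed[OF group_SU_group g] by (auto simp: closed_under_conj_def)
  then show "dagger (\<pi> g) ** S ** \<pi> g \<in> V"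
    by (simp add: conj_action_def unitary_rep_inv[OF rep g])
qed

text \<open>Conjugation by \<open>h\<close> carries the summand at \<open>g\<close> to the summand
  at \<open>g\<close> times the inverse of \<open>h\<close>, and right translation by an element of
  \<open>G\<close> only permutes the sum.\<close>

lemma conj_action_twirl:
  assumes rep: "unitary_rep \<pi>" and G: "subgroup G SU_group" and h: "h \<in> G"
  shows "conj_action \<pi> h (twirl \<pi> G S) = twirl \<pi> G S"
proof -
  interpret SU: group SU_group
    by (rule group_SU_group)
  interpret G: subgroup G SU_group
    by (rule G)
  let ?k = "inv\<^bsub>SU_group\<^esub> h" and ?f = "\<lambda>g. dagger (\<pi> g) ** S ** \<pi> g"
  have summand: "\<pi> h ** ?f g ** dagger (\<pi> h) = ?f (g \<otimes>\<^bsub>SU_group\<^esub> ?k)" if "g \<in> G" for g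
    using that h
    by (simp add: unitary_rep_mult[OF rep] unitary_rep_inv[OF rep] dagger_mult matrix_mul_assoc)
  \<comment> \<open>The two witnesses, right multiplication by \<open>h\<close> and by its inverse,
    are mutually inverse maps of \<open>G\<close> to itself.\<close>
  have "(\<Sum>g\<in>G. \<pi> h ** ?f g ** dagger (\<pi> h)) = (\<Sum>g\<in>G. ?f g)"
    by (rule sum.reindex_bij_witness[of _ "\<lambda>g. g \<otimes>\<^bsub>SU_group\<^esub> h" "\<lambda>g. g \<otimes>\<^bsub>SU_group\<^esub> ?k"])
      (use h summand in \<open>auto simp: SU.m_assoc\<close>)
  then show ?thesis
    by (simp add: conj_action_def twirl_def sandwich_mscale sandwich_sum)
qed

text \<open>This reduces the two claims on inaccessible symmetries to those on decoupling groups: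
  the twirl sends \<open>V\<close> into its fixed operators, which are all scalar.\<close>

lemma inaccessible_symmetry_decoupling:
  assumes rep: "unitary_rep \<pi>" and G: "subgroup G SU_group"
    and V: "cmat.subspace V" "closed_under_conj \<pi> V" "\<S> \<subseteq> V"
    and inacc: "inaccessible_symmetry \<pi> G V"
  shows "decoupling_group \<pi> G \<S>"
  unfolding decoupling_group_def
proof
  fix S assume "S \<in> \<S>"
  then have "twirl \<pi> G S \<in> fixed_operators \<pi> G V"
    using twirl_in_subspace[OF rep subgroup.subset[OF G] V(1,2)] conj_action_twirl[OF rep G] V(3)
    by (auto simp: fixed_operators_def)
  \<comment> \<open>Both alternatives in the definition end up here, because the span contains
    zero.\<close>
  then have "twirl \<pi> G S \<in> cmat.span {mat 1}"
    using inacc cmat.span_zero by (auto simp: inaccessible_symmetry_def)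
  then show "\<exists>c. twirl \<pi> G S = mscale c (mat 1)"
    by (auto simp: cmat.span_singleton)
qed

text \<open>In each summand the adjoint moves to the left vector, so both vectors acquire the same
  factor \<open>u g\<close>, which contributes \<open>cnj (u g) * u g = 1\<close>.\<close>

lemma braket_twirl:
  assumes G: "finite G" "G \<noteq> {}"
    and x: "\<And>g. g \<in> G \<Longrightarrow> \<pi> g *v x = u g *s x"
    and y: "\<And>g. g \<in> G \<Longrightarrow> \<pi> g *v y = u g *s y"
    and u: "\<And>g. g \<in> G \<Longrightarrow> cmod (u g) = 1"
  shows "braket x (twirl \<pi> G S *v y) = braket x (S *v y)"
proof -
  have "braket x ((dagger (\<pi> g) ** S ** \<pi> g) *v y) = braket x (S *v y)" if g: "g \<in> G" for g
  proof -
    have "braket x ((dagger (\<pi> g) ** S ** \<pi> g) *v y) = braket (\<pi> g *v x) (S *v (\<pi> g *v y))"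
      by (simp add: braket_dagger flip: matrix_vector_mul_assoc)
    also have "\<dots> = cnj (u g) * u g * braket x (S *v y)"
      by (simp add: x[OF g] y[OF g] braket_scale vec.scale)
    also have "cnj (u g) * u g = 1"
      using u[OF g] complex_norm_square[of "u g"] by (simp add: mult.commute)
    finally show ?thesis
      by simp
  qed
  \<comment> \<open>The sum consists of \<open>card G\<close> equal terms, and \<open>card G\<close>
    is nonzero, so the normalisation cancels.\<close>
  then show ?thesis
    using G by (simp add: twirl_def mscale_mult_vec sum_mult_vec braket_scale_right braket_sum_right)
qed

text \<open>Eigenvectors for a common eigenvalue form a subspace. This is where the independence of
  the phase from the basis index enters: it extends the phase relation to the whole code
  space.\<close>

lemma eigenvector_span:
  assumes "\<And>x. x \<in> B \<Longrightarrow> A *v x = c *s x" and "x \<in> vec.span B"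
  shows "A *v x = c *s x"
  using assms(2)
  by (induction rule: vec.span_induct_alt)
    (simp_all add: assms(1) vec.add vec.scale mult.commute)

text \<open>The phase relation is required on all of \<open>C\<close> because detection is tested on
  every orthonormal basis of \<open>C\<close>. The constant for an error is the scalar of its
  twirl.\<close>

lemma decoupling_group_detects:
  assumes G: "finite G" "G \<noteq> {}"
    and phase: "\<And>g x. \<lbrakk>g \<in> G; x \<in> C\<rbrakk> \<Longrightarrow> \<pi> g *v x = u g *s x"
    and u: "\<And>g. g \<in> G \<Longrightarrow> cmod (u g) = 1"
    and dec: "decoupling_group \<pi> G \<E>"
  shows "error_detecting_code C \<E>"
  unfolding error_detecting_code_def
proof (intro allI impI ballI)
  fix k \<phi> E
  assume \<phi>: "orthonormal_basis k \<phi> C" and "E \<in> \<E>"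
  then obtain c where c: "twirl \<pi> G E = mscale c (mat 1)"
    using dec by (auto simp: decoupling_group_def)
  have C: "\<phi> i \<in> C" if "i \<in> {1..k}" for i
    using \<phi> that by (auto simp: orthonormal_basis_def intro: vec.span_base)
  have "braket (\<phi> i) (E *v \<phi> j) = (if i = j then c else 0)" if ij: "i \<in> {1..k}" "j \<in> {1..k}" for i j
  proof -
    have "braket (\<phi> i) (E *v \<phi> j) = braket (\<phi> i) (twirl \<pi> G E *v \<phi> j)"
      by (rule braket_twirl[OF G phase phase u, symmetric]) (use C ij in auto)
    also have "\<dots> = c * braket (\<phi> i) (\<phi> j)"
      by (simp add: c mscale_mult_vec braket_scale_right)
    also have "\<dots> = (if i = j then c else 0)"
      using \<phi> ij by (simp add: orthonormal_basis_def)
    finally show ?thesis .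
  qed
  then show "\<exists>c. \<forall>i\<in>{1..k}. \<forall>j\<in>{1..k}. braket (\<phi> i) (E *v \<phi> j) = (if i = j then c else 0)"
    by blast
qed

text \<open>Reading each product as a single error lets the correction claims follow from the
  detection result.\<close>

lemma knill_laflamme_iff_detects_products:
  "knill_laflamme C \<E> \<longleftrightarrow> error_detecting_code C (error_products \<E>)"
  unfolding knill_laflamme_def error_detecting_code_def error_products_def by blast

theorem lemma3:
  fixes \<pi> :: "complex ^ 'd ^ 'd \<Rightarrow> complex ^ 'n ^ 'n"
    and \<E> V\<^sub>1 V\<^sub>2 :: "(complex ^ 'n ^ 'n) set"
    and G :: "(complex ^ 'd ^ 'd) set"
    and H\<^sub>C :: "(complex ^ 'n) set"
    and \<psi> :: "nat \<Rightarrow> complex ^ 'n"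
    and k :: nat
    and \<theta> :: "complex ^ 'd ^ 'd \<Rightarrow> real"
  assumes rep: "unitary_rep \<pi>"
    and V1: "cmat.subspace V\<^sub>1" "closed_under_conj \<pi> V\<^sub>1" "\<E> \<subseteq> V\<^sub>1"
    and V2: "cmat.subspace V\<^sub>2" "closed_under_conj \<pi> V\<^sub>2" "error_products \<E> \<subseteq> V\<^sub>2"
    and G: "subgroup G SU_group" "finite G"
    and code: "orthonormal_basis k \<psi> H\<^sub>C"
    and phase: "\<forall>i\<in>{1..k}. \<forall>g\<in>G. \<pi> g *v \<psi> i = exp (\<i> * of_real (\<theta> g)) *s \<psi> i"
  shows "(decoupling_group \<pi> G \<E> \<longrightarrow> error_detecting_code H\<^sub>C \<E>) \<and>
    (decoupling_group \<pi> G (error_products \<E>) \<longrightarrow>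
      knill_laflamme H\<^sub>C \<E> \<and> error_correcting_code H\<^sub>C \<E>) \<and>
    (inaccessible_symmetry \<pi> G V\<^sub>1 \<longrightarrow> error_detecting_code H\<^sub>C \<E>) \<and>
    (inaccessible_symmetry \<pi> G V\<^sub>2 \<longrightarrow>
      knill_laflamme H\<^sub>C \<E> \<and> error_correcting_code H\<^sub>C \<E>)"
proof -
  have ne: "G \<noteq> {}"
    using subgroup.one_closed[OF G(1)] by auto
  have phase_C: "\<pi> g *v x = exp (\<i> * of_real (\<theta> g)) *s x" if "g \<in> G" "x \<in> H\<^sub>C" for g x
    using code phase that by (auto simp: orthonormal_basis_def intro: eigenvector_span[of "\<psi> ` {1..k}"])
  \<comment> \<open>The set \<open>\<S>\<close> stays arbitrary, to be taken as \<open>\<E>\<close>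
    for detection and as \<open>error_products \<E>\<close> for correction. The side goal left to
    the simplifier is that \<open>exp (\<i> * of_real (\<theta> g))\<close> has modulus one, as
    \<open>\<theta> g\<close> is real.\<close>
  have detects: "error_detecting_code H\<^sub>C \<S>" if "decoupling_group \<pi> G \<S>" for \<S>
    by (rule decoupling_group_detects[OF G(2) ne phase_C _ that]) simp_all
  show ?thesis
    using detects inaccessible_symmetry_decoupling[OF rep G(1) V1]
      inaccessible_symmetry_decoupling[OF rep G(1) V2]
    by (simp add: error_correcting_code_def knill_laflamme_iff_detects_products)
qed

end
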